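(* For any integers $k>n\geq 1$, the following identity holds in $\mathbb{R}[t]$: \[ \sum_{\substack{k_1\geq 2,\ k_2,\ldots,k_n\geq 1,\\ k_1+\cdots+k_n=k}}\zeta^t(k_1,\ldots,k_n) =\Biggl(\sum_{j=0}^{n-1}\binom{k-1}{j}t^j(1-t)^{n-1-j}\Biggr)\zeta(k). \]
   Context: For integers $k_1\geq 2$, $k_2,\ldots,k_n\geq 1$, the multiple zeta value is $\zeta(k_1,\ldots,k_n)=\sum_{m_1>\cdots>m_n>0}m_1^{-k_1}\cdots m_n^{-k_n}$. For such an index, let $\mathbf{p}$ run over all $2^{n-1}$ indices of the form $(k_1\square k_2\square\cdots\square k_n)$ where each $\square$ is filled either by a comma or by a plus sign (plus signs meaning the adjacent entries are added), and let $\sigma(\mathbf{p})$ be the number of plus signs used. Define the polynomial $\zeta^t(k_1,\ldots,k_n)=\sum_{\mathbf{p}}t^{\sigma(\mathbf{p})}\zeta(\mathbf{p})\in\mathbb{R}[t]$ in an indeterminate $t$ (so $\zeta^0$ is the multiple zeta value and $\zeta^1$ the multiple zeta-star value $\sum_{m_1\geq\cdots\geq m_n>0}m_1^{-k_1}\cdots m_n^{-k_n}$). *)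

theory Defs
  imports "HOL-Analysis.Analysis" "HOL-Computational_Algebra.Polynomial"
begin

definition mzv :: "nat list \<Rightarrow> real" where
  "mzv ks = infsum (\<lambda>ms. \<Prod>i<length ks. 1 / real (ms ! i) ^ (ks ! i))
      {ms :: nat list. length ms = length ks \<and> sorted_wrt (>) ms \<and> 0 \<notin> set ms}"

text \<open>All 2^(n-1) indices obtained by filling the gaps with commas or plus signs,
  each paired with the number of plus signs used.\<close>
fun merges :: "nat list \<Rightarrow> (nat list \<times> nat) list" where
  "merges [] = [([], 0)]"
| "merges [k] = [([k], 0)]"
| "merges (k # k' # rest) =
     concat (map (\<lambda>(p, s). [(k # p, s), ((k + hd p) # tl p, Suc s)]) (merges (k' # rest)))"

definition zeta_t :: "nat list \<Rightarrow> real poly" where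
  "zeta_t ks = (\<Sum>(p, s) \<leftarrow> merges ks. monom (mzv p) s)"

definition adm_indices :: "nat \<Rightarrow> nat \<Rightarrow> nat list set" where
  "adm_indices k n = {ks. length ks = n \<and> ks \<noteq> [] \<and> hd ks \<ge> 2 \<and> (\<forall>x\<in>set ks. x \<ge> 1)
      \<and> sum_list ks = k}"

end

(*
  Merging commas into pluses turns a composition into a coarser one, and every composition of k
  with n - s parts and first part at least 2 arises from exactly (k-1-n+s choose s) such
  compositions with n parts. Hence the coefficient of t^s on the left is this binomial coefficient
  times the sum of all multiple zeta values of weight k and depth n - s, which is zeta(k) by the
  classical sum formula, and the theorem reduces to a polynomial identity following from Pascal's rule.

  The sum formula is proved by the connected sums of Seki and Yamamoto. For 0 < x < 1 the connector
    C(m,a) = (1-x)_m (1-x)_a / (1-x)_{m+a}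
  satisfies sum_{a>r} C(m,a)/(a-x) = C(m,r)/m by telescoping, and it is symmetric. Moving the n
  factors 1/m one after another through the connector transforms
    sum_m 1/(m^n (m-x))  into  sum_{m_1>...>m_n} 1/(m_1 (m_1-x) ... (m_n-x)),
  and comparing the coefficients of the powers of x gives the sum formula.
*)
theory Submission
  imports Defs "HOL-Real_Asymp.Real_Asymp"
begin

section \<open>Counting merged indices\<close>

text \<open>The parameter \<open>d\<close> is the excess of the weight over the number of parts.\<close>

definition compositions :: "nat \<Rightarrow> nat \<Rightarrow> nat list set" where
  "compositions d n = {ks. length ks = n \<and> 0 \<notin> set ks \<and> sum_list ks = n + d}"

text \<open>Maps compositions onto indices with first part at least 2, and also describes a plus
  sign between a leading 1 and a merged tail.\<close>

definition incr_hd :: "nat list \<Rightarrow> nat list" where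
  "incr_hd ks = Suc (hd ks) # tl ks"

text \<open>\<open>zeta_t\<close> with an arbitrary \<open>f\<close> in place of \<open>mzv\<close>,
  since the induction below passes from \<open>f\<close> to \<open>f \<circ> Cons 1\<close> and
  \<open>f \<circ> incr_hd\<close>.\<close>

definition merge_poly :: "(nat list \<Rightarrow> 'a::comm_ring_1) \<Rightarrow> nat list \<Rightarrow> 'a poly" where
  "merge_poly f ks = (\<Sum>(p, s) \<leftarrow> merges ks. monom (f p) s)"

lemma compositions_0: "compositions d 0 = (if d = 0 then {[]} else {})"
  by (auto simp: compositions_def)

lemma compositions_1: "compositions d 1 = {[Suc d]}"
  by (auto simp: compositions_def length_Suc_conv)

lemma finite_compositions [simp]: "finite (compositions d n)"
proof (rule finite_subset)
  show "compositions d n \<subseteq> {ks. set ks \<subseteq> {..n + d} \<and> length ks = n}"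
    by (auto simp: compositions_def dest: member_le_sum_list)
qed (simp add: finite_lists_length_eq)

lemma sum_list_ge_length: "0 \<notin> set ks \<Longrightarrow> length ks \<le> sum_list ks" for ks :: "nat list"
  by (induction ks) auto

lemma compositions_Suc_0: "compositions 0 (Suc n) = Cons 1 ` compositions 0 n"
proof (intro equalityI subsetI)
  fix ks assume "ks \<in> compositions 0 (Suc n)"
  then obtain a r where ks: "ks = a # r" and "a > 0" "0 \<notin> set r" "length r = n"
      "a + sum_list r = Suc n"
    by (auto simp: compositions_def length_Suc_conv)
  moreover from this have "n \<le> sum_list r"
    using sum_list_ge_length by blast
  ultimately have "a = 1" "r \<in> compositions 0 n"
    by (auto simp: compositions_def)
  with ks show "ks \<in> Cons 1 ` compositions 0 n"
    by simp
qed (auto simp: compositions_def)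

text \<open>The first part is 1 or can be lowered by one. Dropping a 1 keeps the excess; lowering
  the first part reduces it by one.\<close>

lemma compositions_Suc_Suc:
  "compositions (Suc d) (Suc n) = Cons 1 ` compositions (Suc d) n \<union> incr_hd ` compositions d (Suc n)"
proof (intro equalityI subsetI)
  fix ks assume "ks \<in> compositions (Suc d) (Suc n)"
  then obtain a r where ks: "ks = a # r" and a: "a > 0" "0 \<notin> set r" "length r = n"
      "a + sum_list r = Suc n + Suc d"
    by (auto simp: compositions_def length_Suc_conv)
  show "ks \<in> Cons 1 ` compositions (Suc d) n \<union> incr_hd ` compositions d (Suc n)"
  proof (cases "a = 1")
    case True
    with ks a show ?thesis by (auto simp: compositions_def)
  next
    case False
    with ks a have "ks = incr_hd ((a - 1) # r)" "(a - 1) # r \<in> compositions d (Suc n)"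
      by (auto simp: compositions_def incr_hd_def)
    then show ?thesis by blast
  qed
qed (auto simp: compositions_def incr_hd_def length_Suc_conv)

lemma inj_on_incr_hd: "inj_on incr_hd (compositions d (Suc n))"
  by (rule inj_on_inverseI[where g = "\<lambda>ks. (hd ks - 1) # tl ks"])
     (auto simp: incr_hd_def compositions_def length_Suc_conv)

lemma sum_compositions_Suc_0:
  "(\<Sum>ks\<in>compositions 0 (Suc n). f ks) = (\<Sum>ks\<in>compositions 0 n. f (1 # ks))"
  by (simp add: compositions_Suc_0 sum.reindex)

lemma sum_compositions_Suc_Suc:
  "(\<Sum>ks\<in>compositions (Suc d) (Suc n). f ks) =
     (\<Sum>ks\<in>compositions (Suc d) n. f (1 # ks)) + (\<Sum>ks\<in>compositions d (Suc n). f (incr_hd ks))"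
proof -
  have "Cons 1 ` compositions (Suc d) n \<inter> incr_hd ` compositions d (Suc n) = {}"
  proof -
    have "hd ks > 0" if "ks \<in> compositions d (Suc n)" for ks
      using that by (cases ks) (auto simp: compositions_def)
    then show ?thesis
      by (fastforce simp: incr_hd_def)
  qed
  then show ?thesis
    by (simp add: compositions_Suc_Suc sum.union_disjoint sum.reindex inj_on_incr_hd)
qed

text \<open>The first entry always ends up in the first part of a merged index, so raising it
  commutes with merging.\<close>

lemma merges_incr_hd: "ks \<noteq> [] \<Longrightarrow> merges (incr_hd ks) = map (apfst incr_hd) (merges ks)"
  by (cases ks rule: merges.cases)
     (auto simp: incr_hd_def map_concat intro!: arg_cong[where f = concat])

lemma merge_poly_incr_hd: "ks \<noteq> [] \<Longrightarrow> merge_poly f (incr_hd ks) = merge_poly (f \<circ> incr_hd) ks"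
  by (simp add: merge_poly_def merges_incr_hd o_def split_def)

text \<open>The gap after the leading 1 holds a comma, which prepends 1 to the merged tail, or a
  plus, which raises its head and contributes a factor \<open>t\<close>, here
  \<open>monom 1 1\<close>.\<close>

lemma merge_poly_Cons_1:
  assumes "ks \<noteq> []"
  shows "merge_poly f (1 # ks) = merge_poly (f \<circ> Cons 1) ks + monom 1 1 * merge_poly (f \<circ> incr_hd) ks"
proof -
  have "(\<Sum>(p, s) \<leftarrow> concat (map (\<lambda>(p, s). [(1 # p, s), ((1 + hd p) # tl p, Suc s)]) ps). monom (f p) s) =
      (\<Sum>(p, s) \<leftarrow> ps. monom (f (1 # p)) s) + monom 1 1 * (\<Sum>(p, s) \<leftarrow> ps. monom (f (incr_hd p)) s)" for ps
    by (induction ps) (auto simp: incr_hd_def algebra_simps mult_monom)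
  then show ?thesis
    using assms by (cases ks) (simp_all add: merge_poly_def o_def)
qed

text \<open>Splitting on the first part leaves the raised compositions with coefficient
  \<open>(d + s) choose s\<close>; Pascal's rule divides it between the last two terms, belonging to
  \<open>s - 1\<close> and \<open>d - 1\<close>.\<close>

lemma choose_mult_sum_compositions:
  fixes f :: "nat list \<Rightarrow> 'a::comm_ring_1"
  shows "of_nat ((d + s) choose s) * (\<Sum>p\<in>compositions (d + s) (Suc (Suc n) - s). f p) =
    of_nat ((d + s) choose s) * (\<Sum>p\<in>compositions (d + s) (Suc n - s). f (1 # p))
    + (case s of 0 \<Rightarrow> 0 | Suc r \<Rightarrow>
        of_nat ((d + r) choose r) * (\<Sum>p\<in>compositions (d + r) (Suc n - r). f (incr_hd p)))
    + (case d of 0 \<Rightarrow> 0 | Suc e \<Rightarrow>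
        of_nat ((e + s) choose s) * (\<Sum>p\<in>compositions (e + s) (Suc (Suc n) - s). f (incr_hd p)))"
proof (cases "s \<le> Suc n")
  case True
  then have *: "Suc (Suc n) - s = Suc (Suc n - s)" by simp
  show ?thesis
    by (cases s; cases d)
       (use * in \<open>simp_all add: sum_compositions_Suc_0 sum_compositions_Suc_Suc algebra_simps\<close>)
\<comment> \<open>For larger \<open>s\<close> the truncated lengths are 0 while the excesses are
  positive, so every sum is empty.\<close>
qed (auto split: nat.split simp: compositions_0)

text \<open>A composition either starts with 1 or is obtained from one of smaller weight by
  incrementing its first part; both sides satisfy the recursion given by this case distinction.\<close>

lemma sum_merge_poly_compositions:
  fixes f :: "nat list \<Rightarrow> 'a::comm_ring_1"
  shows "(\<Sum>ks\<in>compositions d (Suc n). merge_poly f ks) =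
    (\<Sum>s\<le>n. monom (of_nat ((d + s) choose s) * (\<Sum>p\<in>compositions (d + s) (Suc n - s). f p)) s)"
    (is "_ = ?H d n f")
proof (induction n arbitrary: d f)
  case 0
  show ?case by (simp add: compositions_1[simplified] merge_poly_def)
next
  case (Suc n)
  have ne: "ks \<noteq> []" if "ks \<in> compositions d (Suc n)" for d n ks
    using that by (auto simp: compositions_def)
  \<comment> \<open>Holds for every \<open>s\<close>: beyond \<open>n\<close> the truncated length
    is 0 and the excess positive.\<close>
  have coeff_H: "coeff (?H d n f) s =
      of_nat ((d + s) choose s) * (\<Sum>p\<in>compositions (d + s) (Suc n - s). f p)"
    for d n s and f :: "nat list \<Rightarrow> 'a"
    by (cases "s \<le> n") (simp_all add: coeff_sum compositions_0)
  have H_rec: "?H d (Suc n) f = ?H d n (f \<circ> Cons 1) + monom 1 1 * ?H d n (f \<circ> incr_hd)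
      + (case d of 0 \<Rightarrow> 0 | Suc e \<Rightarrow> ?H e (Suc n) (f \<circ> incr_hd))" for d f
  proof (rule poly_eqI)
    fix s
    show "coeff (?H d (Suc n) f) s = coeff (?H d n (f \<circ> Cons 1) + monom 1 1 * ?H d n (f \<circ> incr_hd)
      + (case d of 0 \<Rightarrow> 0 | Suc e \<Rightarrow> ?H e (Suc n) (f \<circ> incr_hd))) s"
      using choose_mult_sum_compositions[of d s f n]
      by (cases s; cases d) (simp_all only: coeff_H coeff_add coeff_monom_mult o_def nat.case coeff_0, simp_all)
  qed
  have Cons_1: "(\<Sum>ks\<in>compositions d (Suc n). merge_poly f (1 # ks)) =
      ?H d n (f \<circ> Cons 1) + monom 1 1 * ?H d n (f \<circ> incr_hd)" for d f
  proof -
    have "(\<Sum>ks\<in>compositions d (Suc n). merge_poly f (1 # ks)) =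
        (\<Sum>ks\<in>compositions d (Suc n). merge_poly (f \<circ> Cons 1) ks + monom 1 1 * merge_poly (f \<circ> incr_hd) ks)"
      by (intro sum.cong merge_poly_Cons_1 refl ne)
    then show ?thesis
      by (simp only: sum.distrib sum_distrib_left[symmetric] Suc.IH)
  qed
  \<comment> \<open>Undoing \<open>incr_hd\<close> keeps the length and lowers only the excess,
    hence an inner induction on \<open>d\<close>.\<close>
  show ?case
  proof (induction d arbitrary: f)
    case 0
    show ?case
      by (simp only: sum_compositions_Suc_0 Cons_1 H_rec[of 0] nat.case add_0_right)
  next
    case (Suc d)
    have "(\<Sum>ks\<in>compositions d (Suc (Suc n)). merge_poly f (incr_hd ks)) = ?H d (Suc n) (f \<circ> incr_hd)"
      unfolding Suc.IH[symmetric] by (intro sum.cong merge_poly_incr_hd refl ne)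
    then show ?case
      by (simp only: sum_compositions_Suc_Suc Cons_1 H_rec[of "Suc d"] nat.case)
  qed
qed

text \<open>By Pascal's rule, passing from \<open>n\<close> to \<open>Suc n\<close> multiplies the
  old left side by \<open>(1 - t) + t = 1\<close> and adds exactly the new last term of the right
  side.\<close>

lemma sum_choose_binomial:
  fixes t :: "'a::comm_ring_1"
  shows "(\<Sum>j\<le>n. of_nat ((Suc n + d) choose j) * (t ^ j * (1 - t) ^ (n - j))) =
    (\<Sum>s\<le>n. of_nat ((d + s) choose s) * t ^ s)"
proof (induction n)
  case (Suc n)
  let ?R = "\<lambda>n. \<Sum>j\<le>n. of_nat ((Suc n + d) choose j) * (t ^ j * (1 - t) ^ (n - j))"
  have "?R (Suc n) = (1 - t) ^ Suc n + (\<Sum>j\<le>n. of_nat ((Suc n + d) choose Suc j) * (t ^ Suc j * (1 - t) ^ (n - j)))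
     + t * ?R n"
    by (subst sum.atMost_Suc_shift) (simp add: sum.distrib algebra_simps sum_distrib_left)
  also have "(1 - t) ^ Suc n + (\<Sum>j\<le>n. of_nat ((Suc n + d) choose Suc j) * (t ^ Suc j * (1 - t) ^ (n - j)))
     = (\<Sum>j\<le>Suc n. of_nat ((Suc n + d) choose j) * (t ^ j * (1 - t) ^ (Suc n - j)))"
    by (subst sum.atMost_Suc_shift) simp
  also have "\<dots> = (1 - t) * ?R n + of_nat ((Suc n + d) choose Suc n) * t ^ Suc n"
    by (simp add: sum_distrib_left Suc_diff_le algebra_simps)
  finally show ?case using Suc by (simp add: algebra_simps)
qed simp

section \<open>The sum formula for multiple zeta values\<close>

text \<open>The difference series vanishes on \<open>(0, 1)\<close>. Once its lower coefficients are
  zero, dividing by \<open>x ^ d\<close> and letting \<open>x\<close> tend to 0 from the right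
  isolates coefficient \<open>d\<close>.\<close>

lemma powser_coeffs_eq:
  fixes a b :: "nat \<Rightarrow> real"
  assumes "\<And>x. 0 < x \<Longrightarrow> x < 1 \<Longrightarrow> (\<lambda>d. a d * x ^ d) sums f x"
    and "\<And>x. 0 < x \<Longrightarrow> x < 1 \<Longrightarrow> (\<lambda>d. b d * x ^ d) sums f x"
  shows "a d = b d"
proof -
  define c where "c d = a d - b d" for d
  have c0: "(\<lambda>d. c d * x ^ d) sums 0" if "0 < x" "x < 1" for x
    using sums_diff[OF assms(1)[OF that] assms(2)[OF that]] by (simp add: c_def algebra_simps)
  have "c d = 0"
  proof (induction d rule: less_induct)
    case (less d)
    have shift: "(\<lambda>k. c (k + d) * x ^ k) sums 0" if x: "0 < x" "x < 1" for x
    proof -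
      have "(\<lambda>k. c (k + d) * x ^ (k + d)) sums 0"
        using c0[OF x] less by (subst sums_zero_iff_shift) auto
      from sums_mult[OF this, of "1 / x ^ d"] show ?thesis
        using x by (simp add: power_add)
    qed
    define g where "g x = (\<Sum>k. c (k + d) * x ^ k)" for x
    have "(g \<longlongrightarrow> c (0 + d)) (at 0)"
    proof (rule powser_limit_0[where a = "\<lambda>k. c (k + d)" and s = 1])
      fix x :: real assume "norm x < 1"
      \<comment> \<open>The point \<open>(1 + \<bar>x\<bar>) / 2\<close> lies strictly between
        \<open>\<bar>x\<bar>\<close> and 1, so convergence there covers \<open>x\<close> of either
        sign.\<close>
      then have "summable (\<lambda>k. c (k + d) * x ^ k)"
        by (intro powser_inside[OF sums_summable[OF shift[of "(1 + \<bar>x\<bar>) / 2"]]]) auto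
      then show "(\<lambda>k. c (k + d) * x ^ k) sums g x"
        by (simp add: g_def summable_sums)
    qed simp
    then have "(g \<longlongrightarrow> c d) (at_right 0)"
      by (simp add: filterlim_at_split)
    moreover have "\<forall>\<^sub>F x in at_right 0. g x = 0"
      using eventually_at_right_real[OF zero_less_one]
      by eventually_elim (use shift in \<open>auto simp: g_def sums_iff\<close>)
    then have "(g \<longlongrightarrow> 0) (at_right 0)"
      by (rule tendsto_eventually)
    ultimately show "c d = 0"
      by (intro tendsto_unique[of "at_right 0"]) auto
  qed
  then show ?thesis by (simp add: c_def)
qed

text \<open>Tonelli: nonnegativity turns convergence of the iterated sum into joint
  summability.\<close>

lemma has_sum_SigmaI_nonneg:
  fixes f :: "'a \<times> 'b \<Rightarrow> real"
  assumes "\<And>x. x \<in> A \<Longrightarrow> ((\<lambda>y. f (x, y)) has_sum g x) (B x)" "(g has_sum S) A"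
    and "\<And>x y. x \<in> A \<Longrightarrow> y \<in> B x \<Longrightarrow> f (x, y) \<ge> 0"
  shows "(f has_sum S) (Sigma A B)"
  using assms summable_on_SigmaI[OF assms(1) _ assms(3)] has_sum_imp_summable
  by (intro has_sum_SigmaI) blast+

section \<open>Telescoping sums of the connector\<close>

definition connector :: "real \<Rightarrow> nat \<Rightarrow> nat \<Rightarrow> real" where
  "connector x m a = pochhammer (1 - x) m * pochhammer (1 - x) a / pochhammer (1 - x) (m + a)"

lemma connector_commute: "connector x m a = connector x a m"
  by (simp add: connector_def add.commute)

context
  fixes x :: real
  assumes x: "0 < x" "x < 1"
begin

lemma pochhammer_1_minus_pos: "pochhammer (1 - x) m > 0"
  using x by (intro pochhammer_pos) auto

lemma connector_0_right [simp]: "connector x m 0 = 1"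
  using pochhammer_1_minus_pos[of m] by (simp add: connector_def)

lemma connector_0_left [simp]: "connector x 0 a = 1"
  by (simp add: connector_commute[of x 0])

lemma connector_nonneg [simp]: "connector x m a \<ge> 0"
  using pochhammer_1_minus_pos[of m] pochhammer_1_minus_pos[of a] pochhammer_1_minus_pos[of "m + a"]
  by (simp add: connector_def)

lemma connector_Suc_left:
  "connector x (Suc m) a = connector x m a * ((real (Suc m) - x) / (real (Suc m + a) - x))"
  using pochhammer_1_minus_pos[of "m + a"] x
  by (simp add: connector_def pochhammer_Suc divide_simps) (simp add: algebra_simps)

lemma connector_le_1: "connector x m a \<le> 1"
proof (induction m)
  case 0
  show ?case by (simp add: connector_commute[of x 0])
next
  case (Suc m)
  have "(real (Suc m) - x) / (real (Suc m + a) - x) \<le> 1"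
    using x by (simp add: divide_simps)
  then show ?case
    using Suc x unfolding connector_Suc_left by (intro mult_le_one) auto
qed

text \<open>All factors but one are bounded by \<open>connector_le_1\<close>; the remaining one
  decays like \<open>1 / a\<close>.\<close>

lemma connector_LIMSEQ: "connector x (Suc m) \<longlonglongrightarrow> 0"
proof (rule tendsto_sandwich[where f = "\<lambda>_. 0"])
  show "\<forall>\<^sub>F a in sequentially. connector x (Suc m) a \<le> (real (Suc m) - x) / (real (Suc m + a) - x)"
  proof (intro always_eventually allI)
    fix a
    have "(real (Suc m) - x) / (real (Suc m + a) - x) \<ge> 0"
      using x by simp
    from mult_right_mono[OF connector_le_1 this]
    show "connector x (Suc m) a \<le> (real (Suc m) - x) / (real (Suc m + a) - x)"
      unfolding connector_Suc_left by simp
  qed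
  show "(\<lambda>a. (real (Suc m) - x) / (real (Suc m + a) - x)) \<longlonglongrightarrow> 0"
    by real_asymp
qed auto

text \<open>The source of the telescoping: the ratio of consecutive connectors, moved to the second
  argument by symmetry.\<close>

lemma connector_diff:
  "connector x m a - connector x m (Suc a) = m * (connector x m (Suc a) / (real (Suc a) - x))"
proof -
  have "connector x m (Suc a) = connector x m a * ((real (Suc a) - x) / (real (Suc a + m) - x))"
    by (metis connector_Suc_left connector_commute)
  then show ?thesis
    using x by (simp add: divide_simps) (simp add: algebra_simps)
qed

lemma has_sum_connector:
  assumes "m > 0"
  shows "((\<lambda>a. connector x m a / (a - x)) has_sum (connector x m r / m)) {r<..}"
proof -
  obtain m' where m: "m = Suc m'" using assms by (cases m) auto
  have "(\<lambda>j. connector x m (j + r) - connector x m (Suc j + r)) sums (connector x m (0 + r) - 0)"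
    by (rule telescope_sums') (use LIMSEQ_ignore_initial_segment[OF connector_LIMSEQ, of m' r] m in simp)
  from sums_divide[OF this, of m]
  have "(\<lambda>j. connector x m (Suc (j + r)) / (real (Suc (j + r)) - x)) sums (connector x m r / m)"
    using assms by (simp add: connector_diff)
  then have "((\<lambda>j. connector x m (Suc (j + r)) / (real (Suc (j + r)) - x)) has_sum (connector x m r / m)) UNIV"
    using x by (intro sums_nonneg_imp_has_sum) auto
  also have "?this \<longleftrightarrow> ?thesis"
    by (rule has_sum_reindex_bij_witness[where i = "\<lambda>a. a - Suc r" and j = "\<lambda>j. Suc (j + r)"]) auto
  finally show ?thesis .
qed

text \<open>Since \<open>connector x 1 m = (1 - x) / (m + 1 - x)\<close>, the telescoping series
  with first argument 1 dominates; the factor 2 comes from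
  \<open>m + 1 - x \<le> 2 * m\<close>.\<close>

lemma summable_inverse_power_minus:
  assumes "n > 0"
  shows "(\<lambda>m. 1 / (real m ^ n * (m - x))) summable_on {0<..}"
proof (rule summable_on_comparison_test)
  show "(\<lambda>m. 2 / (1 - x) * (connector x 1 m / (m - x))) summable_on {0<..}"
    by (intro summable_on_cmult_right has_sum_imp_summable[OF has_sum_connector]) simp
  fix m :: nat assume "m \<in> {0<..}"
  then have m: "real m \<ge> 1" by simp
  have "1 / (real m ^ n * (m - x)) \<le> 1 / (real m * (m - x))"
    using m x assms self_le_power[of "real m" n] by (intro divide_left_mono mult_right_mono) auto
  also have "\<dots> \<le> 2 / (real m + 1 - x) / (m - x)"
    using m x by (simp add: divide_simps)
  also have "\<dots> = 2 / (1 - x) * (connector x 1 m / (m - x))"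
    using x connector_Suc_left[of 0 m]
    by (simp add: connector_commute[of x 0] add_ac) (simp add: divide_simps)
  finally show "1 / (real m ^ n * (m - x)) \<le> 2 / (1 - x) * (connector x 1 m / (m - x))" .
  show "0 \<le> 1 / (real m ^ n * (m - x))" using m x by simp
qed

end

section \<open>Transport of factors through the connector\<close>

definition decr_lists :: "nat \<Rightarrow> nat list set" where
  "decr_lists n = {ms. length ms = n \<and> sorted_wrt (>) ms \<and> 0 \<notin> set ms}"

text \<open>In \<open>hd (ms @ [0])\<close>, the \<open>0\<close> only serves as the head of the empty list.\<close>

lemma Cons_mem_decr_lists:
  "m # ms \<in> decr_lists (Suc n) \<longleftrightarrow> ms \<in> decr_lists n \<and> m > hd (ms @ [0])"
  by (cases ms) (auto simp: decr_lists_def)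

lemma mem_decr_lists_SucD:
  assumes "ms \<in> decr_lists (Suc n)"
  shows "hd ms # tl ms = ms" "tl ms \<in> decr_lists n" "hd (tl ms @ [0]) < hd ms"
  using assms by (cases ms; simp add: Cons_mem_decr_lists; simp add: decr_lists_def)+

lemma hd_decr_lists_pos: "ms \<in> decr_lists (Suc n) \<Longrightarrow> hd ms > 0"
  by (cases ms) (auto simp: decr_lists_def)

definition inv_minus_prod :: "real \<Rightarrow> nat list \<Rightarrow> real" where
  "inv_minus_prod x ms = (\<Prod>m\<leftarrow>ms. 1 / (m - x))"

context
  fixes x :: real
  assumes x: "0 < x" "x < 1"
begin

lemma inv_minus_prod_nonneg: "0 \<notin> set ms \<Longrightarrow> inv_minus_prod x ms \<ge> 0"
  using x by (induction ms) (auto simp: inv_minus_prod_def)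

text \<open>Intermediate stage after \<open>j\<close> factors \<open>1 / m\<close> have been moved.
  A step replaces \<open>connector x m r / m\<close>, with \<open>r\<close> the head of
  \<open>ms\<close>, by the sum of \<open>connector x m a / (a - x)\<close> over
  \<open>a > r\<close>, and \<open>a\<close> becomes the new head; the total is unchanged.\<close>

lemma has_sum_connected:
  assumes n: "n > 0" and "j \<le> n"
  shows "((\<lambda>(ms, m). inv_minus_prod x ms * connector x m (hd (ms @ [0])) / (real m ^ (n - j) * (m - x)))
     has_sum (\<Sum>\<^sub>\<infinity>m\<in>{0<..}. 1 / (real m ^ n * (m - x)))) (decr_lists j \<times> {0<..})"
  using \<open>j \<le> n\<close>
proof (induction j)
  case 0
  have "((\<lambda>m. 1 / (real m ^ n * (m - x))) has_sum (\<Sum>\<^sub>\<infinity>m\<in>{0<..}. 1 / (real m ^ n * (m - x)))) {0<..}"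
    using summable_inverse_power_minus[OF x n] by (rule has_sum_infsum)
  also have "?this \<longleftrightarrow> ?case"
    using x by (intro has_sum_reindex_bij_witness[where i = snd and j = "\<lambda>m. ([], m)"])
      (auto simp: decr_lists_def inv_minus_prod_def)
  finally show ?case .
next
  case (Suc j)
  let ?S = "\<Sum>\<^sub>\<infinity>m\<in>{0<..}. 1 / (real m ^ n * (m - x))"
  let ?g = "\<lambda>ms m. inv_minus_prod x ms / (real m ^ (n - Suc j) * (m - x))"
  have pow: "real m ^ (n - j) = m * real m ^ (n - Suc j)" for m
    using Suc.prems by (simp flip: power_Suc add: Suc_diff_Suc)
  have "((\<lambda>((ms, m), a). ?g ms m * (connector x m a / (a - x)))
      has_sum ?S) (SIGMA (ms, m):decr_lists j \<times> {0<..}. {hd (ms @ [0])<..})"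
  proof (rule has_sum_SigmaI_nonneg[where g = "\<lambda>(ms, m). inv_minus_prod x ms *
      connector x m (hd (ms @ [0])) / (real m ^ (n - j) * (m - x))"], goal_cases)
    case (1 p)
    then obtain ms m where p: "p = (ms, m)" "m > 0" by auto
    have "((\<lambda>a. ?g ms m * (connector x m a / (a - x))) has_sum
        (?g ms m * (connector x m (hd (ms @ [0])) / m))) {hd (ms @ [0])<..}"
      by (intro has_sum_cmult_right has_sum_connector x p)
    then show ?case
      by (simp add: p pow mult_ac)
  next
    case 2
    show ?case using Suc by simp
  next
    case (3 p a)
    then obtain ms m where p: "p = (ms, m)" "0 \<notin> set ms" "m > 0" "a > 0"
      by (auto simp: decr_lists_def)
    then show ?case
      using x inv_minus_prod_nonneg[of ms]
      by (auto intro!: mult_nonneg_nonneg divide_nonneg_nonneg connector_nonneg)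
  qed
  also have "?this \<longleftrightarrow> ?case"
    by (rule has_sum_reindex_bij_witness[where i = "\<lambda>(ms, m). ((tl ms, m), hd ms)"
          and j = "\<lambda>((ms, m), a). (a # ms, m)"])
       (auto simp: Cons_mem_decr_lists inv_minus_prod_def mem_decr_lists_SucD)
  finally show ?case .
qed

text \<open>For \<open>j = n\<close> no power of \<open>m\<close> is left; by symmetry the sum over
  \<open>m\<close> telescopes to \<open>connector x (hd ms) 0 / hd ms\<close>, where the connector
  is 1.\<close>

lemma has_sum_inv_minus_prod:
  assumes n: "n > 0"
  shows "((\<lambda>ms. inv_minus_prod x ms / hd ms) has_sum (\<Sum>\<^sub>\<infinity>m\<in>{0<..}. 1 / (real m ^ n * (m - x)))) (decr_lists n)"
proof (rule has_sum_SigmaD[OF has_sum_connected[OF n order_refl]])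
  fix ms assume "ms \<in> decr_lists n"
  then obtain n' where ms: "ms \<in> decr_lists (Suc n')"
    using n by (cases n) auto
  then have "ms \<noteq> []" "hd ms > 0"
    using hd_decr_lists_pos by (auto simp: decr_lists_def)
  then have "((\<lambda>m. inv_minus_prod x ms * (connector x (hd ms) m / (m - x))) has_sum
      (inv_minus_prod x ms * (connector x (hd ms) 0 / hd ms))) {0<..}"
    by (intro has_sum_cmult_right has_sum_connector x)
  then show "((\<lambda>y. case (ms, y) of (ms, m) \<Rightarrow>
        inv_minus_prod x ms * connector x m (hd (ms @ [0])) / (real m ^ (n - n) * (m - x)))
      has_sum (inv_minus_prod x ms / hd ms)) {0<..}"
    using \<open>ms \<noteq> []\<close> by (simp add: connector_commute[of x "hd ms"] connector_0_left[OF x])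
qed

end

section \<open>Expansion in powers of \<open>x\<close>\<close>

definition pow_prod :: "nat list \<Rightarrow> nat list \<Rightarrow> real" where
  "pow_prod ms ks = (\<Prod>(m, k)\<leftarrow>zip ms ks. 1 / real m ^ k)"

lemma pow_prod_nonneg [simp]: "pow_prod ms ks \<ge> 0"
  by (auto simp: pow_prod_def intro!: prod_list_nonneg)

lemma pow_prod_nth:
  "length ms = length ks \<Longrightarrow> (\<Prod>i<length ks. 1 / real (ms ! i) ^ (ks ! i)) = pow_prod ms ks"
  by (induction ms ks rule: list_induct2) (simp_all add: pow_prod_def prod.lessThan_Suc_shift del: prod.lessThan_Suc)

lemma mzv_conv_pow_prod: "mzv ks = (\<Sum>\<^sub>\<infinity>ms\<in>decr_lists (length ks). pow_prod ms ks)"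
  unfolding mzv_def decr_lists_def by (intro infsum_cong) (simp add: pow_prod_nth)

lemma mzv_singleton: "mzv [k] = (\<Sum>\<^sub>\<infinity>m\<in>{0<..}. 1 / real m ^ k)"
  unfolding mzv_conv_pow_prod
  by (rule infsum_reindex_bij_witness[where i = "\<lambda>m. [m]" and j = hd])
     (auto simp: decr_lists_def pow_prod_def length_Suc_conv)

lemma pow_prod_incr_hd:
  "length ms = length ks \<Longrightarrow> ms \<noteq> [] \<Longrightarrow> pow_prod ms (incr_hd ks) = pow_prod ms ks / hd ms"
  by (cases ms; cases ks) (auto simp: pow_prod_def incr_hd_def)

definition pos_lists :: "nat \<Rightarrow> nat list set" where
  "pos_lists n = {ks. length ks = n \<and> 0 \<notin> set ks}"

context
  fixes x :: real
  assumes x: "0 < x" "x < 1"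
begin

lemma has_sum_geometric_inverse_minus:
  assumes "m > 0"
  shows "((\<lambda>k. x ^ k / real m ^ k) has_sum (x / (m - x))) {0<..}"
proof -
  have "(\<lambda>k. x / m * (x / m) ^ k) sums (x / m * (1 / (1 - x / m)))"
    using x assms by (intro sums_mult geometric_sums) auto
  then have "((\<lambda>k. x / m * (x / m) ^ k) has_sum (x / (m - x))) UNIV"
    using x assms by (intro sums_nonneg_imp_has_sum) (auto simp: field_simps)
  also have "?this \<longleftrightarrow> ?thesis"
    by (rule has_sum_reindex_bij_witness[where i = "\<lambda>k. k - 1" and j = Suc]) (auto simp: power_divide)
  finally show ?thesis .
qed

text \<open>Product of the geometric series for \<open>x / (m - x)\<close>, one for each entry of
  \<open>ms\<close>.\<close>

lemma has_sum_pow_prod: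
  assumes "0 \<notin> set ms"
  shows "((\<lambda>ks. x ^ sum_list ks * pow_prod ms ks) has_sum (x ^ length ms * inv_minus_prod x ms))
    (pos_lists (length ms))"
  using assms
proof (induction ms)
  case Nil
  have "pos_lists 0 = {[]}" by (auto simp: pos_lists_def)
  then show ?case by (simp add: pow_prod_def inv_minus_prod_def has_sum_finite_iff)
next
  case (Cons m ms)
  let ?c = "x ^ length ms * inv_minus_prod x ms"
  have "((\<lambda>(ks, k). (x ^ sum_list ks * pow_prod ms ks) * (x ^ k / real m ^ k)) has_sum
      ?c * (x / (m - x))) (pos_lists (length ms) \<times> {0<..})"
  proof (rule has_sum_SigmaI_nonneg)
    show "((\<lambda>ks. x ^ sum_list ks * pow_prod ms ks * (x / (m - x))) has_sum ?c * (x / (m - x)))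
        (pos_lists (length ms))"
      using Cons by (intro has_sum_cmult_left) auto
    show "((\<lambda>k. case (ks, k) of (ks, k) \<Rightarrow> x ^ sum_list ks * pow_prod ms ks * (x ^ k / real m ^ k))
        has_sum x ^ sum_list ks * pow_prod ms ks * (x / (m - x))) {0<..}" for ks
      using Cons.prems by (simp only: prod.case) (intro has_sum_cmult_right has_sum_geometric_inverse_minus, simp)
  qed (use x in auto)
  also have "?this \<longleftrightarrow> ?case"
    by (rule has_sum_reindex_bij_witness[where i = "\<lambda>ks. (tl ks, hd ks)" and j = "\<lambda>(ks, k). k # ks"])
       (auto simp: pos_lists_def length_Suc_conv pow_prod_def inv_minus_prod_def power_add)
  finally show ?case .
qed

text \<open>A nonnegative double sum taken in both orders: \<open>ks\<close> first leads to
  \<open>has_sum_inv_minus_prod\<close>, \<open>ms\<close> first to multiple zeta values. The factor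
  \<open>1 / hd ms\<close> is what \<open>incr_hd\<close> contributes.\<close>

lemma has_sum_mzv_pos_lists:
  assumes n: "n > 0"
  shows "((\<lambda>ks. x ^ sum_list ks * mzv (incr_hd ks)) has_sum
    (x ^ n * (\<Sum>\<^sub>\<infinity>m\<in>{0<..}. 1 / (real m ^ n * (m - x))))) (pos_lists n)"
proof -
  let ?S = "x ^ n * (\<Sum>\<^sub>\<infinity>m\<in>{0<..}. 1 / (real m ^ n * (m - x)))"
  have "((\<lambda>(ms, ks). x ^ sum_list ks * pow_prod ms (incr_hd ks)) has_sum ?S) (decr_lists n \<times> pos_lists n)"
  proof (rule has_sum_SigmaI_nonneg)
    show "((\<lambda>ms. x ^ n * (inv_minus_prod x ms / hd ms)) has_sum ?S) (decr_lists n)"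
      by (intro has_sum_cmult_right has_sum_inv_minus_prod n x)
    fix ms assume ms: "ms \<in> decr_lists n"
    then have "((\<lambda>ks. x ^ sum_list ks * pow_prod ms ks / hd ms) has_sum
        (x ^ n * inv_minus_prod x ms / hd ms)) (pos_lists n)"
      using has_sum_cmult_left[OF has_sum_pow_prod[of ms], of "1 / hd ms"]
      by (auto simp: decr_lists_def)
    also have "?this \<longleftrightarrow> ((\<lambda>ks. case (ms, ks) of (ms, ks) \<Rightarrow> x ^ sum_list ks * pow_prod ms (incr_hd ks)) has_sum
        (x ^ n * (inv_minus_prod x ms / hd ms))) (pos_lists n)"
      using ms n by (subst times_divide_eq_right, intro has_sum_cong)
        (auto simp: decr_lists_def pos_lists_def pow_prod_incr_hd)
    finally show "\<dots>" .
  qed (use x in auto)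
  then have swapped: "((\<lambda>(ks, ms). x ^ sum_list ks * pow_prod ms (incr_hd ks)) has_sum ?S)
      (pos_lists n \<times> decr_lists n)"
    by (subst (asm) has_sum_swap) simp
  show ?thesis
  proof (rule has_sum_SigmaD[OF swapped])
    fix ks assume ks: "ks \<in> pos_lists n"
    then have len: "length (incr_hd ks) = n"
      using n by (auto simp: pos_lists_def incr_hd_def)
    \<comment> \<open>\<open>infsum\<close> defaults to 0 on non-summable families, so summability
      of the inner sum is extracted from the double sum first.\<close>
    have "(\<lambda>ms. x ^ sum_list ks * pow_prod ms (incr_hd ks)) summable_on decr_lists n"
      using summable_on_SigmaD1[OF has_sum_imp_summable[OF swapped] ks] .
    then have "(\<lambda>ms. pow_prod ms (incr_hd ks)) summable_on decr_lists n"
      using x by (simp add: summable_on_cmult_right')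
    then have "((\<lambda>ms. pow_prod ms (incr_hd ks)) has_sum mzv (incr_hd ks)) (decr_lists n)"
      unfolding mzv_conv_pow_prod len by (rule has_sum_infsum)
    then show "((\<lambda>ms. case (ks, ms) of (ks, ms) \<Rightarrow> x ^ sum_list ks * pow_prod ms (incr_hd ks))
        has_sum x ^ sum_list ks * mzv (incr_hd ks)) (decr_lists n)"
      by (simp add: has_sum_cmult_right)
  qed
qed

lemma sums_sum_mzv_compositions:
  assumes n: "n > 0"
  shows "(\<lambda>d. (\<Sum>ks\<in>compositions d n. mzv (incr_hd ks)) * x ^ d) sums
    (\<Sum>\<^sub>\<infinity>m\<in>{0<..}. 1 / (real m ^ n * (m - x)))"
proof -
  let ?S = "\<Sum>\<^sub>\<infinity>m\<in>{0<..}. 1 / (real m ^ n * (m - x))"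
  have "((\<lambda>ks. x ^ sum_list ks * mzv (incr_hd ks)) has_sum (x ^ n * ?S)) (pos_lists n)"
    by (rule has_sum_mzv_pos_lists[OF n])
  \<comment> \<open>Grouping by \<open>d = sum_list ks - n\<close>, a true difference because all
    parts are positive.\<close>
  also have "?this \<longleftrightarrow> ((\<lambda>(d, ks). x ^ (n + d) * mzv (incr_hd ks)) has_sum (x ^ n * ?S))
      (SIGMA d:UNIV. compositions d n)"
    by (rule has_sum_reindex_bij_witness[where i = snd and j = "\<lambda>ks. (sum_list ks - n, ks)"])
       (auto simp: pos_lists_def compositions_def sum_list_ge_length)
  finally have "((\<lambda>d. \<Sum>ks\<in>compositions d n. x ^ (n + d) * mzv (incr_hd ks)) has_sum (x ^ n * ?S)) UNIV"
    by (rule has_sum_SigmaD) (simp add: has_sum_finite_iff)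
  then have "(\<lambda>d. \<Sum>ks\<in>compositions d n. x ^ (n + d) * mzv (incr_hd ks)) sums (x ^ n * ?S)"
    by (rule has_sum_imp_sums)
  from sums_divide[OF this, of "x ^ n"] show ?thesis
    using x by (simp add: power_add sum_distrib_left sum_divide_distrib mult_ac)
qed

text \<open>Expanding \<open>1 / (m - x)\<close> geometrically yields the value from
  \<open>sums_sum_mzv_compositions\<close> again, now with single zeta values as
  coefficients.\<close>

lemma sums_mzv_singleton:
  assumes n: "n > 0"
  shows "(\<lambda>d. mzv [Suc n + d] * x ^ d) sums (\<Sum>\<^sub>\<infinity>m\<in>{0<..}. 1 / (real m ^ n * (m - x)))"
proof -
  let ?S = "\<Sum>\<^sub>\<infinity>m\<in>{0<..}. 1 / (real m ^ n * (m - x))"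
  have "((\<lambda>(m, d). x ^ d * (1 / real m ^ (Suc n + d))) has_sum ?S) ({0<..} \<times> UNIV)"
  proof (rule has_sum_SigmaI_nonneg)
    show "((\<lambda>m. 1 / (real m ^ n * (m - x))) has_sum ?S) {0<..}"
      using summable_inverse_power_minus[OF x n] by (rule has_sum_infsum)
    fix m :: nat assume m: "m \<in> {0<..}"
    \<comment> \<open>The geometric series starts at \<open>k = 1\<close>; the factor
      \<open>1 / (x * real m ^ n)\<close> and \<open>d = k - 1\<close> shift its start to 0.\<close>
    have "((\<lambda>k. x ^ k / real m ^ k * (1 / (x * real m ^ n))) has_sum (x / (m - x) * (1 / (x * real m ^ n)))) {0<..}"
      using m by (intro has_sum_cmult_left has_sum_geometric_inverse_minus) simp
    also have "?this \<longleftrightarrow> ((\<lambda>d. case (m, d) of (m, d) \<Rightarrow> x ^ d * (1 / real m ^ (Suc n + d)))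
        has_sum (1 / (real m ^ n * (m - x)))) UNIV"
      using x m
      by (intro has_sum_reindex_bij_witness[where j = "\<lambda>k. k - 1" and i = Suc])
         (auto simp: gr0_conv_Suc power_add)
    finally show "\<dots>" .
  qed (use x in auto)
  then have swapped: "((\<lambda>(d, m). x ^ d * (1 / real m ^ (Suc n + d))) has_sum ?S) (UNIV \<times> {0<..})"
    by (subst (asm) has_sum_swap) simp
  have "((\<lambda>d. mzv [Suc n + d] * x ^ d) has_sum ?S) UNIV"
  proof (rule has_sum_SigmaD[OF swapped])
    fix d :: nat
    have "(\<lambda>m. x ^ d * (1 / real m ^ (Suc n + d))) summable_on {0<..}"
      using summable_on_SigmaD1[OF has_sum_imp_summable[OF swapped] UNIV_I] .
    then have "(\<lambda>m. 1 / real m ^ (Suc n + d)) summable_on {0<..}"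
      using x by (subst (asm) summable_on_cmult_right') auto
    then have "((\<lambda>m. 1 / real m ^ (Suc n + d)) has_sum mzv [Suc n + d]) {0<..}"
      unfolding mzv_singleton by (rule has_sum_infsum)
    from has_sum_cmult_right[OF this, of "x ^ d"]
    show "((\<lambda>m. case (d, m) of (d, m) \<Rightarrow> x ^ d * (1 / real m ^ (Suc n + d)))
        has_sum mzv [Suc n + d] * x ^ d) {0<..}"
      by (simp add: mult.commute)
  qed
  then show ?thesis by (rule has_sum_imp_sums)
qed

end

section \<open>Coefficient comparison and assembly\<close>

lemma smult_sum_right: "smult c (\<Sum>i\<in>A. p i) = (\<Sum>i\<in>A. smult c (p i))"
  by (induction A rule: infinite_finite_induct) (simp_all add: smult_add_right)

lemma sum_formula:
  assumes "n > 0"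
  shows "(\<Sum>ks\<in>compositions d n. mzv (incr_hd ks)) = mzv [Suc n + d]"
  by (rule powser_coeffs_eq[OF sums_sum_mzv_compositions sums_mzv_singleton]) (use assms in auto)

text \<open>Raising the first part makes it at least 2 and the weight \<open>Suc n + d\<close>
  instead of \<open>n + d\<close>.\<close>

lemma adm_indices_conv_compositions:
  "adm_indices (Suc n + d) n = incr_hd ` compositions d n" if "n > 0"
proof (intro equalityI subsetI)
  fix ks assume ks: "ks \<in> adm_indices (Suc n + d) n"
  then have "ks = incr_hd ((hd ks - 1) # tl ks)"
    by (cases ks) (auto simp: adm_indices_def incr_hd_def)
  moreover have "(hd ks - 1) # tl ks \<in> compositions d n"
    using ks by (cases ks) (auto simp: adm_indices_def compositions_def)
  ultimately show "ks \<in> incr_hd ` compositions d n" by blast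
next
  fix ks assume "ks \<in> incr_hd ` compositions d n"
  then obtain ks' where ks': "ks = incr_hd ks'" "ks' \<in> compositions d n" by blast
  with that obtain a r where "ks' = a # r"
    by (cases ks') (auto simp: compositions_def)
  with ks' have "ks = Suc a # r" "a # r \<in> compositions d n"
    by (simp_all add: incr_hd_def)
  then show "ks \<in> adm_indices (Suc n + d) n"
    by (auto simp: adm_indices_def compositions_def Suc_le_eq intro: gr0I)
qed

theorem theorem1p1:
  fixes k n :: nat
  assumes "1 \<le> n" and "n < k"
  shows "(\<Sum>ks\<in>adm_indices k n. zeta_t ks) =
    smult (mzv [k])
      (\<Sum>j = 0..n - 1. smult (of_nat ((k - 1) choose j)) ([:0, 1:] ^ j * [:1, -1:] ^ (n - 1 - j)))"
proof -
  obtain n' where n': "n = Suc n'"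
    using assms by (cases n) auto
  obtain d where k: "k = Suc n + d"
    using assms by (metis add_Suc less_imp_Suc_add)
  have "(\<Sum>ks\<in>adm_indices k n. zeta_t ks) = (\<Sum>ks\<in>compositions d n. merge_poly mzv (incr_hd ks))"
    unfolding k n' adm_indices_conv_compositions[OF zero_less_Suc]
    by (simp add: sum.reindex inj_on_incr_hd merge_poly_def zeta_t_def)
  also have "\<dots> = (\<Sum>ks\<in>compositions d n. merge_poly (mzv \<circ> incr_hd) ks)"
    by (intro sum.cong refl merge_poly_incr_hd) (auto simp: compositions_def n')
  \<comment> \<open>Depth \<open>Suc n' - s\<close> and excess \<open>d + s\<close> give weight
    \<open>k\<close> for every \<open>s\<close>, so the sum formula turns each inner sum into
    \<open>mzv [k]\<close>.\<close>
  also have "\<dots> = (\<Sum>s\<le>n'. monom (of_nat ((d + s) choose s) * mzv [k]) s)"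
    unfolding n' sum_merge_poly_compositions
  proof (intro sum.cong refl)
    fix s assume "s \<in> {..n'}"
    then show "monom (of_nat ((d + s) choose s) * (\<Sum>p\<in>compositions (d + s) (Suc n' - s). (mzv \<circ> incr_hd) p)) s
        = monom (of_nat ((d + s) choose s) * mzv [k]) s"
      by (simp add: sum_formula k n' o_def Suc_diff_le)
  qed
  also have "\<dots> = smult (mzv [k]) (\<Sum>s\<le>n'. of_nat ((d + s) choose s) * [:0, 1:] ^ s)"
    by (simp add: monom_altdef of_nat_poly mult.commute smult_sum_right)
  \<comment> \<open>The binomial identity at the indeterminate \<open>t = [:0, 1:]\<close>, where
    \<open>Suc n' + d = k - 1\<close>.\<close>
  also have "(\<Sum>s\<le>n'. of_nat ((d + s) choose s) * [:0, 1 :: real:] ^ s) =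
      (\<Sum>j\<le>n'. of_nat ((Suc n' + d) choose j) * ([:0, 1:] ^ j * (1 - [:0, 1:]) ^ (n' - j)))"
    by (rule sum_choose_binomial[symmetric])
  also have "1 - [:0, 1 :: real:] = [:1, -1:]"
    by (simp add: one_pCons)
  finally show ?thesis
    by (simp add: k n' atMost_atLeast0 of_nat_poly)
qed

end
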